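(* Let $M$ be a weakly o-minimal metric structure expanding a model of $\mathsf{UDLO}$, let $A \subseteq M$, and let $D \subseteq M$ be compact and $A$-definable. Then every $b \in D$ is $A$-definable. Consequently $\mathrm{acl}(A) = \mathrm{dcl}(A)$.
   Context: A metric linear order is a set with a linear order $\le$ and metric $d$ such that every open ball is order-convex, with ray predicate $r(x,y)=\inf_{z\le y}d(x,z)$. $\mathsf{UDLO}$ is the theory of complete metric linear orders of diameter $\le1$ with ultrametric metric such that for every $a$ both $\{d(a,b):b<a\}$ and $\{d(a,b):b>a\}$ are dense in $[0,1]$. A structure $M$ in a language containing $r$ that expands a metric linear order is weakly o-minimal if the interpretation of every definable predicate (with parameters) in one variable is weakly regulated, i.e. a uniform limit of functions in the $\mathbb{R}$-linear span of characteristic functions of order-convex subsets of $M$. A closed nonempty $D\subseteq M$ is $A$-definable if $d(x,D)$ is a definable predicate over $A$; $b$ is $A$-definable if $\{b\}$ is; $\mathrm{dcl}(A)$ is the set of $A$-definable points and $\mathrm{acl}(A)$ the set of points lying in some compact $A$-definable set. *)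

theory Defs
  imports "HOL-Analysis.Analysis"
begin

definition (in linorder) order_convex :: "'a set \<Rightarrow> bool" where
  "order_convex S \<longleftrightarrow> (\<forall>x\<in>S. \<forall>y\<in>S. \<forall>z. x \<le> z \<and> z \<le> y \<longrightarrow> z \<in> S)"

class metric_linear_order = linorder + metric_space +
  assumes order_convex_ball: "order_convex {b. dist a b < e}"

definition ray :: "'a::metric_linear_order \<Rightarrow> 'a \<Rightarrow> real" where
  "ray x y = (INF z\<in>{..y}. dist x z)"

class udlo = metric_linear_order + complete_space +
  assumes dist_le_one: "dist a b \<le> 1"
    and ultrametric: "dist a c \<le> max (dist a b) (dist b c)"
    and dense_dist_below: "{0..1} \<subseteq> closure {dist a b | b. b < a}"
    and dense_dist_above: "{0..1} \<subseteq> closure {dist a b | b. a < b}"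

text \<open>
  A metric structure in the sense of continuous logic, bundled with the arities of its
  signature. The universe is the type \<open>'m\<close>; the metric is \<open>dist\<close>; constants are function
  symbols of arity 0. Interpretations are only meaningful on lists of the right length.
  Moduli of uniform continuity are not recorded, only their existence is required
  (in \<open>is_metric_structure\<close>), since they play no role for a single structure.
\<close>

record ('m, 'f, 'p) metric_structure =
  fun_arity :: "'f \<Rightarrow> nat"
  pred_arity :: "'p \<Rightarrow> nat"
  fun_interp :: "'f \<Rightarrow> 'm list \<Rightarrow> 'm"
  pred_interp :: "'p \<Rightarrow> 'm list \<Rightarrow> real"

definition uniformly_continuous_nary ::
    "nat \<Rightarrow> ('a::metric_space list \<Rightarrow> 'b::metric_space) \<Rightarrow> bool" where
  "uniformly_continuous_nary n f \<longleftrightarrow>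
    (\<forall>\<epsilon>>0. \<exists>\<delta>>0. \<forall>xs ys. length xs = n \<and> length ys = n \<and>
       (\<forall>i<n. dist (xs ! i) (ys ! i) < \<delta>) \<longrightarrow> dist (f xs) (f ys) < \<epsilon>)"

definition is_metric_structure :: "('m::complete_space, 'f, 'p) metric_structure \<Rightarrow> bool" where
  "is_metric_structure M \<longleftrightarrow>
    (\<forall>x y::'m. dist x y \<le> 1) \<and>
    (\<forall>f. uniformly_continuous_nary (fun_arity M f) (fun_interp M f)) \<and>
    (\<forall>p. uniformly_continuous_nary (pred_arity M p) (pred_interp M p)) \<and>
    (\<forall>p xs. length xs = pred_arity M p \<longrightarrow> pred_interp M p xs \<in> {0..1})"

text \<open>
  \<open>Param a\<close> is the constant symbol naming the element \<open>a\<close> of the structure. In \<open>Conn u \<phi>s\<close>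
  the connective \<open>u\<close> is meant as a continuous function from \<open>[0,1]\<^sup>n\<close> to \<open>[0,1]\<close> with
  \<open>n = length \<phi>s\<close>, where \<open>[0,1]\<^sup>n\<close> is represented as a \<open>PiE\<close> with the product topology.
\<close>

datatype ('m, 'f) tm = Var nat | Param 'm | Fun 'f "('m, 'f) tm list"

datatype ('m, 'f, 'p) fm =
    Dist "('m, 'f) tm" "('m, 'f) tm"
  | Pred 'p "('m, 'f) tm list"
  | Conn "(nat \<Rightarrow> real) \<Rightarrow> real" "('m, 'f, 'p) fm list"
  | QSup nat "('m, 'f, 'p) fm"
  | QInf nat "('m, 'f, 'p) fm"

definition unit_cube :: "nat \<Rightarrow> (nat \<Rightarrow> real) set" where
  "unit_cube n = (\<Pi>\<^sub>E i\<in>{..<n}. {0..1})"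

fun tm_over :: "('m, 'f, 'p) metric_structure \<Rightarrow> 'm set \<Rightarrow> ('m, 'f) tm \<Rightarrow> bool" where
  "tm_over M A (Var i) \<longleftrightarrow> True"
| "tm_over M A (Param a) \<longleftrightarrow> a \<in> A"
| "tm_over M A (Fun f ts) \<longleftrightarrow> length ts = fun_arity M f \<and> (\<forall>t\<in>set ts. tm_over M A t)"

fun fm_over :: "('m, 'f, 'p) metric_structure \<Rightarrow> 'm set \<Rightarrow> ('m, 'f, 'p) fm \<Rightarrow> bool" where
  "fm_over M A (Dist s t) \<longleftrightarrow> tm_over M A s \<and> tm_over M A t"
| "fm_over M A (Pred p ts) \<longleftrightarrow> length ts = pred_arity M p \<and> (\<forall>t\<in>set ts. tm_over M A t)"
| "fm_over M A (Conn u \<phi>s) \<longleftrightarrow>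
     continuous_on (unit_cube (length \<phi>s)) u \<and> u ` unit_cube (length \<phi>s) \<subseteq> {0..1} \<and>
     (\<forall>\<phi>\<in>set \<phi>s. fm_over M A \<phi>)"
| "fm_over M A (QSup i \<phi>) \<longleftrightarrow> fm_over M A \<phi>"
| "fm_over M A (QInf i \<phi>) \<longleftrightarrow> fm_over M A \<phi>"

fun tm_vars :: "('m, 'f) tm \<Rightarrow> nat set" where
  "tm_vars (Var i) = {i}"
| "tm_vars (Param a) = {}"
| "tm_vars (Fun f ts) = (\<Union>t\<in>set ts. tm_vars t)"

fun free_vars :: "('m, 'f, 'p) fm \<Rightarrow> nat set" where
  "free_vars (Dist s t) = tm_vars s \<union> tm_vars t"
| "free_vars (Pred p ts) = (\<Union>t\<in>set ts. tm_vars t)"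
| "free_vars (Conn u \<phi>s) = (\<Union>\<phi>\<in>set \<phi>s. free_vars \<phi>)"
| "free_vars (QSup i \<phi>) = free_vars \<phi> - {i}"
| "free_vars (QInf i \<phi>) = free_vars \<phi> - {i}"

fun tm_val :: "('m, 'f, 'p) metric_structure \<Rightarrow> (nat \<Rightarrow> 'm) \<Rightarrow> ('m, 'f) tm \<Rightarrow> 'm" where
  "tm_val M e (Var i) = e i"
| "tm_val M e (Param a) = a"
| "tm_val M e (Fun f ts) = fun_interp M f (map (tm_val M e) ts)"

fun fm_val ::
    "('m::metric_space, 'f, 'p) metric_structure \<Rightarrow> (nat \<Rightarrow> 'm) \<Rightarrow> ('m, 'f, 'p) fm \<Rightarrow> real" where
  "fm_val M e (Dist s t) = dist (tm_val M e s) (tm_val M e t)"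
| "fm_val M e (Pred p ts) = pred_interp M p (map (tm_val M e) ts)"
| "fm_val M e (Conn u \<phi>s) = u (\<lambda>i\<in>{..<length \<phi>s}. map (fm_val M e) \<phi>s ! i)"
| "fm_val M e (QSup i \<phi>) = (SUP a. fm_val M (e(i := a)) \<phi>)"
| "fm_val M e (QInf i \<phi>) = (INF a. fm_val M (e(i := a)) \<phi>)"

text \<open>
  Definable predicates in one variable, the variable being \<open>Var 0\<close>. The values of the
  assignment at the other variables are irrelevant.
\<close>

definition definable_pred ::
    "('m::metric_space, 'f, 'p) metric_structure \<Rightarrow> 'm set \<Rightarrow> ('m \<Rightarrow> real) \<Rightarrow> bool" where
  "definable_pred M A P \<longleftrightarrow>
    (\<exists>\<phi>. (\<forall>k. fm_over M A (\<phi> k) \<and> free_vars (\<phi> k) \<subseteq> {0}) \<and>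
         uniform_limit UNIV (\<lambda>k x. fm_val M (\<lambda>_. x) (\<phi> k)) P sequentially)"

definition definable_set ::
    "('m::metric_space, 'f, 'p) metric_structure \<Rightarrow> 'm set \<Rightarrow> 'm set \<Rightarrow> bool" where
  "definable_set M A D \<longleftrightarrow> closed D \<and> D \<noteq> {} \<and> definable_pred M A (\<lambda>x. infdist x D)"

definition definable_point ::
    "('m::metric_space, 'f, 'p) metric_structure \<Rightarrow> 'm set \<Rightarrow> 'm \<Rightarrow> bool" where
  "definable_point M A b \<longleftrightarrow> definable_set M A {b}"

definition dcl :: "('m::metric_space, 'f, 'p) metric_structure \<Rightarrow> 'm set \<Rightarrow> 'm set" where
  "dcl M A = {b. definable_point M A b}"

definition acl :: "('m::metric_space, 'f, 'p) metric_structure \<Rightarrow> 'm set \<Rightarrow> 'm set" where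
  "acl M A = {b. \<exists>D. compact D \<and> definable_set M A D \<and> b \<in> D}"

definition convex_step_function :: "('m::linorder \<Rightarrow> real) \<Rightarrow> bool" where
  "convex_step_function g \<longleftrightarrow>
    (\<exists>\<C> c. finite \<C> \<and> (\<forall>C\<in>\<C>. order_convex C) \<and> g = (\<lambda>x. \<Sum>C\<in>\<C>. c C * indicator C x))"

definition weakly_regulated :: "('m::linorder \<Rightarrow> real) \<Rightarrow> bool" where
  "weakly_regulated f \<longleftrightarrow>
    (\<exists>g. (\<forall>n. convex_step_function (g n)) \<and> uniform_limit UNIV g f sequentially)"

definition has_ray_symbol ::
    "('m::metric_linear_order, 'f, 'p) metric_structure \<Rightarrow> bool" where
  "has_ray_symbol M \<longleftrightarrow>
    (\<exists>\<rho>. pred_arity M \<rho> = 2 \<and> (\<forall>x y. pred_interp M \<rho> [x, y] = ray x y))"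

definition weakly_o_minimal ::
    "('m::{metric_linear_order, complete_space}, 'f, 'p) metric_structure \<Rightarrow> bool" where
  "weakly_o_minimal M \<longleftrightarrow>
    is_metric_structure M \<and> has_ray_symbol M \<and>
    (\<forall>P. definable_pred M UNIV P \<longrightarrow> weakly_regulated P)"

end

theory Submission imports Defs begin

text \<open>
  The largest element \<open>b\<close> of a compact \<open>A\<close>-definable set \<open>D\<close> is \<open>A\<close>-definable, because its distance
  predicate is \<open>max (d(x,D)) (sup\<^sub>y (r(y,x) - d(y,D)))\<close>. If \<open>c\<close> is \<open>A\<close>-definable, then
  \<open>D\<close> minus the open \<open>\<epsilon>\<close>-ball around \<open>c\<close> is again compact and \<open>A\<close>-definable: balls are clopen, so
  the distances from \<open>c\<close> to \<open>D\<close> omit an interval just below \<open>\<epsilon>\<close>. Were some point of \<open>D\<close> at distance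
  at least \<open>\<epsilon>\<close> from all \<open>A\<close>-definable points of \<open>D\<close>, removing finitely many \<open>\<epsilon>\<close>-balls around such
  points would leave a nonempty set whose maximum is a definable point that should have been removed.
  Hence the \<open>A\<close>-definable points are dense in \<open>D\<close>, and limits of definable points are definable.
\<close>

section \<open>Definable predicates on assignments\<close>

text \<open>Needed because suprema and infima in \<open>real\<close> are meaningful only for bounded
  families, and connectives are controlled only on the unit cube.\<close>

lemma fm_val_in_unit:
  fixes M :: "('m::complete_space, 'f, 'p) metric_structure"
  assumes "is_metric_structure M" "fm_over M A \<phi>"
  shows "fm_val M e \<phi> \<in> {0..1}"
  using assms(2)
proof (induction \<phi> arbitrary: e)
  case (Dist s t)
  then show ?case using assms(1) by (simp add: is_metric_structure_def)
next
  case (Pred p ts)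
  then have "length (map (tm_val M e) ts) = pred_arity M p" by simp
  then show ?case using assms(1) unfolding is_metric_structure_def fm_val.simps by blast
next
  case (Conn u \<phi>s)
  have "(\<lambda>i\<in>{..<length \<phi>s}. map (fm_val M e) \<phi>s ! i) \<in> unit_cube (length \<phi>s)"
    using Conn by (auto simp: unit_cube_def)
  then show ?case using Conn.prems by (simp add: image_subset_iff)
next
  case (QSup i \<phi>)
  then have b: "fm_val M (e(i := a)) \<phi> \<in> {0..1}" for a by simp
  then have "bdd_above (range (\<lambda>a. fm_val M (e(i := a)) \<phi>))"
    by (intro bdd_aboveI[of _ 1]) auto
  then have "0 \<le> (SUP a. fm_val M (e(i := a)) \<phi>)"
    by (rule cSUP_upper2[where x = undefined]) (use b in auto)
  moreover have "(SUP a. fm_val M (e(i := a)) \<phi>) \<le> 1"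
    by (rule cSUP_least) (use b in auto)
  ultimately show ?case by simp
next
  case (QInf i \<phi>)
  then have b: "fm_val M (e(i := a)) \<phi> \<in> {0..1}" for a by simp
  then have "bdd_below (range (\<lambda>a. fm_val M (e(i := a)) \<phi>))"
    by (intro bdd_belowI[of _ 0]) auto
  then have "(INF a. fm_val M (e(i := a)) \<phi>) \<le> 1"
    by (rule cINF_lower2[where x = undefined]) (use b in auto)
  moreover have "0 \<le> (INF a. fm_val M (e(i := a)) \<phi>)"
    by (rule cINF_greatest) (use b in auto)
  ultimately show ?case by simp
qed

lemma tm_val_cong:
  assumes "\<And>i. i \<in> tm_vars t \<Longrightarrow> e i = e' i"
  shows "tm_val M e t = tm_val M e' t"
  using assms
proof (induction t)
  case (Fun f ts)
  then have "map (tm_val M e) ts = map (tm_val M e') ts"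
    by (intro map_cong) auto
  then show ?case by (simp only: tm_val.simps)
qed auto

lemma fm_val_cong:
  assumes "\<And>i. i \<in> free_vars \<phi> \<Longrightarrow> e i = e' i"
  shows "fm_val M e \<phi> = fm_val M e' \<phi>"
  using assms
proof (induction \<phi> arbitrary: e e')
  case (Dist s t)
  then have "tm_val M e s = tm_val M e' s" "tm_val M e t = tm_val M e' t"
    by (auto intro!: tm_val_cong)
  then show ?case by simp
next
  case (Pred p ts)
  then have "map (tm_val M e) ts = map (tm_val M e') ts"
    by (intro map_cong refl tm_val_cong) auto
  then show ?case by (simp only: fm_val.simps)
next
  case (Conn u \<phi>s)
  have "fm_val M e \<phi> = fm_val M e' \<phi>" if "\<phi> \<in> set \<phi>s" for \<phi>
    by (rule Conn.IH[OF that]) (use that Conn.prems in auto)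
  then have "map (fm_val M e) \<phi>s = map (fm_val M e') \<phi>s"
    by (rule map_cong[OF refl])
  then show ?case by (simp only: fm_val.simps)
next
  case (QSup i \<phi>)
  have "fm_val M (e(i := a)) \<phi> = fm_val M (e'(i := a)) \<phi>" for a
    by (rule QSup.IH) (use QSup.prems in auto)
  then show ?case by (simp only: fm_val.simps)
next
  case (QInf i \<phi>)
  have "fm_val M (e(i := a)) \<phi> = fm_val M (e'(i := a)) \<phi>" for a
    by (rule QInf.IH) (use QInf.prems in auto)
  then show ?case by (simp only: fm_val.simps)
qed

text \<open>Predicates depend on whole assignments, so quantifiers become updates
  \<open>e(i := a)\<close> and the set \<open>V\<close> records the variables involved. Asking for
  one formula per error bound replaces the approximating sequences of
  \<open>definable_pred\<close>.\<close>

definition env_definable ::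
    "('m::metric_space, 'f, 'p) metric_structure \<Rightarrow> 'm set \<Rightarrow> nat set \<Rightarrow> ((nat \<Rightarrow> 'm) \<Rightarrow> real) \<Rightarrow> bool"
  where "env_definable M A V P \<longleftrightarrow>
    (\<forall>\<epsilon>>0. \<exists>\<phi>. fm_over M A \<phi> \<and> free_vars \<phi> \<subseteq> V \<and> (\<forall>e. \<bar>fm_val M e \<phi> - P e\<bar> < \<epsilon>))"

text \<open>Formulas with no free variable other than 0 cannot tell \<open>e\<close> from the
  constant assignment \<open>\<lambda>_. e 0\<close>. Conversely, errors \<open>1/(k+1)\<close> give
  a uniformly convergent sequence.\<close>

lemma definable_pred_iff_env_definable:
  "definable_pred M A P \<longleftrightarrow> env_definable M A {0} (\<lambda>e. P (e 0))"
proof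
  assume "definable_pred M A P"
  then obtain \<phi> where \<phi>: "\<And>k. fm_over M A (\<phi> k)" "\<And>k. free_vars (\<phi> k) \<subseteq> {0}"
    and lim: "uniform_limit UNIV (\<lambda>k x. fm_val M (\<lambda>_. x) (\<phi> k)) P sequentially"
    unfolding definable_pred_def by blast
  have val: "fm_val M e (\<phi> k) = fm_val M (\<lambda>_. e 0) (\<phi> k)" for e k
    using \<phi>(2)[of k] by (intro fm_val_cong) auto
  show "env_definable M A {0} (\<lambda>e. P (e 0))"
    unfolding env_definable_def
  proof (intro allI impI)
    fix \<epsilon> :: real assume "\<epsilon> > 0"
    then obtain k where "\<And>x. dist (fm_val M (\<lambda>_. x) (\<phi> k)) (P x) < \<epsilon>"
      using lim unfolding uniform_limit_sequentially_iff by blast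
    then show "\<exists>\<phi>. fm_over M A \<phi> \<and> free_vars \<phi> \<subseteq> {0} \<and> (\<forall>e. \<bar>fm_val M e \<phi> - P (e 0)\<bar> < \<epsilon>)"
      using \<phi> val by (metis dist_real_def)
  qed
next
  assume def: "env_definable M A {0} (\<lambda>e. P (e 0))"
  have "\<exists>\<phi>. fm_over M A \<phi> \<and> free_vars \<phi> \<subseteq> {0} \<and>
      (\<forall>e. \<bar>fm_val M e \<phi> - P (e 0)\<bar> < inverse (real (Suc k)))" for k
    using def unfolding env_definable_def by simp
  then obtain \<phi> where \<phi>: "\<And>k. fm_over M A (\<phi> k)" "\<And>k. free_vars (\<phi> k) \<subseteq> {0}"
    and close: "\<And>k e. \<bar>fm_val M e (\<phi> k) - P (e 0)\<bar> < inverse (real (Suc k))"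
    by metis
  have "uniform_limit UNIV (\<lambda>k x. fm_val M (\<lambda>_. x) (\<phi> k)) P sequentially"
    unfolding uniform_limit_sequentially_iff
  proof (intro allI impI)
    fix \<epsilon> :: real assume "\<epsilon> > 0"
    then obtain N where N: "inverse (real (Suc N)) < \<epsilon>" using reals_Archimedean by blast
    have "dist (fm_val M (\<lambda>_. x) (\<phi> n)) (P x) < \<epsilon>" if "n \<ge> N" for n x
    proof -
      have "inverse (real (Suc n)) \<le> inverse (real (Suc N))"
        using that by (intro le_imp_inverse_le) auto
      then show ?thesis using close[of "\<lambda>_. x" n] N unfolding dist_real_def by linarith
    qed
    then show "\<exists>N. \<forall>n\<ge>N. \<forall>x\<in>UNIV. dist (fm_val M (\<lambda>_. x) (\<phi> n)) (P x) < \<epsilon>" by blast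
  qed
  then show "definable_pred M A P" unfolding definable_pred_def using \<phi> by blast
qed

section \<open>Closure of definable predicates under limits, connectives and quantifiers\<close>

lemma env_definable_mono: "env_definable M A V P \<Longrightarrow> V \<subseteq> W \<Longrightarrow> env_definable M A W P"
  unfolding env_definable_def by (meson subset_trans)

lemma env_definable_limit:
  assumes "\<And>\<epsilon>. \<epsilon> > 0 \<Longrightarrow> \<exists>Q. env_definable M A V Q \<and> (\<forall>e. \<bar>Q e - P e\<bar> < \<epsilon>)"
  shows "env_definable M A V P"
  unfolding env_definable_def
proof (intro allI impI)
  fix \<epsilon> :: real assume "\<epsilon> > 0"
  then obtain Q where Q: "env_definable M A V Q" "\<And>e. \<bar>Q e - P e\<bar> < \<epsilon> / 2"
    using assms[of "\<epsilon> / 2"] by auto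
  obtain \<phi> where \<phi>: "fm_over M A \<phi>" "free_vars \<phi> \<subseteq> V" "\<And>e. \<bar>fm_val M e \<phi> - Q e\<bar> < \<epsilon> / 2"
    using Q(1) \<open>\<epsilon> > 0\<close> unfolding env_definable_def by (metis half_gt_zero)
  have "\<bar>fm_val M e \<phi> - P e\<bar> < \<epsilon>" for e
    using Q(2)[of e] \<phi>(3)[of e] by linarith
  then show "\<exists>\<phi>. fm_over M A \<phi> \<and> free_vars \<phi> \<subseteq> V \<and> (\<forall>e. \<bar>fm_val M e \<phi> - P e\<bar> < \<epsilon>)"
    using \<phi> by blast
qed

lemma env_definable_in_unit:
  fixes M :: "('m::complete_space, 'f, 'p) metric_structure"
  assumes "is_metric_structure M" "env_definable M A V P"
  shows "P e \<in> {0..1}"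
proof -
  have bounds: "0 \<le> P e + \<epsilon>" "P e \<le> 1 + \<epsilon>" if pos: "\<epsilon> > 0" for \<epsilon>
  proof -
    obtain \<phi> where "fm_over M A \<phi>" "\<bar>fm_val M e \<phi> - P e\<bar> < \<epsilon>"
      using assms(2) pos unfolding env_definable_def by blast
    then show "0 \<le> P e + \<epsilon>" "P e \<le> 1 + \<epsilon>"
      using fm_val_in_unit[OF assms(1), of A \<phi> e] by auto
  qed
  have "0 \<le> P e" by (rule field_le_epsilon) (rule bounds)
  moreover have "P e \<le> 1" by (rule field_le_epsilon) (rule bounds)
  ultimately show ?thesis by simp
qed

lemma env_definable_dist: "env_definable M A {i, j} (\<lambda>e. dist (e i) (e j))"
  unfolding env_definable_def by (intro allI impI exI[of _ "Dist (Var i) (Var j)"]) simp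

lemma env_definable_ray:
  assumes "has_ray_symbol M"
  shows "env_definable M A {i, j} (\<lambda>e. ray (e i) (e j))"
proof -
  obtain \<rho> where "pred_arity M \<rho> = 2" "\<And>x y. pred_interp M \<rho> [x, y] = ray x y"
    using assms unfolding has_ray_symbol_def by blast
  then show ?thesis
    unfolding env_definable_def by (intro allI impI exI[of _ "Pred \<rho> [Var i, Var j]"]) simp
qed

text \<open>By compactness \<open>u\<close> is uniformly continuous on the unit square, so applying
  it to good approximations of \<open>P\<close> and \<open>Q\<close> gives a good approximation of
  the result.\<close>

lemma env_definable_conn2:
  fixes M :: "('m::complete_space, 'f, 'p) metric_structure"
  assumes M: "is_metric_structure M"
    and P: "env_definable M A V P" and Q: "env_definable M A V Q"
    and cont: "continuous_on ({0..1} \<times> {0..1}) (\<lambda>(s, t). u s t)"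
    and range: "\<And>s t. s \<in> {0..1} \<Longrightarrow> t \<in> {0..1} \<Longrightarrow> u s t \<in> {0..1}"
  shows "env_definable M A V (\<lambda>e. u (P e) (Q e))"
  unfolding env_definable_def
proof (intro allI impI)
  fix \<epsilon> :: real assume "\<epsilon> > 0"
  have "uniformly_continuous_on ({0..1} \<times> {0..1}) (\<lambda>(s, t). u s t)"
    using cont by (intro compact_uniformly_continuous compact_Times) auto
  then obtain \<delta> where \<delta>: "\<delta> > 0"
    "\<And>x y. \<lbrakk>x \<in> {0..1} \<times> {0..1}; y \<in> {0..1} \<times> {0..1}; dist y x < \<delta>\<rbrakk>
      \<Longrightarrow> dist ((\<lambda>(s, t). u s t) y) ((\<lambda>(s, t). u s t) x) < \<epsilon>"
    using \<open>\<epsilon> > 0\<close> unfolding uniformly_continuous_on_def by meson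
  obtain \<phi> where \<phi>: "fm_over M A \<phi>" "free_vars \<phi> \<subseteq> V" "\<And>e. \<bar>fm_val M e \<phi> - P e\<bar> < \<delta> / 2"
    using P \<delta>(1) unfolding env_definable_def by (metis half_gt_zero)
  obtain \<psi> where \<psi>: "fm_over M A \<psi>" "free_vars \<psi> \<subseteq> V" "\<And>e. \<bar>fm_val M e \<psi> - Q e\<bar> < \<delta> / 2"
    using Q \<delta>(1) unfolding env_definable_def by (metis half_gt_zero)
  \<comment> \<open>Coordinates 0 and 1 are the positions of the two formulas in the argument list
    of \<open>Conn\<close>.\<close>
  let ?u = "\<lambda>f. u (f 0) (f (1::nat))"
  let ?\<theta> = "Conn ?u [\<phi>, \<psi>]"
  have cube: "(f 0, f 1) \<in> {0..1} \<times> {0..1}" if "f \<in> unit_cube 2" for f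
    using that unfolding unit_cube_def by (auto simp: PiE_iff)
  have "continuous_on (unit_cube 2) (\<lambda>f. (f (0::nat), f 1))"
    by (intro continuous_on_Pair continuous_on_subset[OF continuous_on_product_coordinates]) auto
  then have "continuous_on (unit_cube 2) ((\<lambda>(s, t). u s t) \<circ> (\<lambda>f. (f 0, f 1)))"
    by (rule continuous_on_compose) (use cube in \<open>blast intro: continuous_on_subset[OF cont]\<close>)
  then have "continuous_on (unit_cube 2) ?u" by (simp add: comp_def)
  moreover have "?u ` unit_cube 2 \<subseteq> {0..1}"
    using cube range by blast
  ultimately have "fm_over M A ?\<theta>" using \<phi> \<psi> by (simp add: numeral_2_eq_2)
  moreover have "free_vars ?\<theta> \<subseteq> V" using \<phi> \<psi> by simp
  moreover have "\<bar>fm_val M e ?\<theta> - u (P e) (Q e)\<bar> < \<epsilon>" for e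
  proof -
    have "dist (fm_val M e \<phi>, fm_val M e \<psi>) (P e, Q e)
        \<le> \<bar>fm_val M e \<phi> - P e\<bar> + \<bar>fm_val M e \<psi> - Q e\<bar>"
      unfolding dist_Pair_Pair dist_real_def by (rule sqrt_sum_squares_le_sum_abs[THEN order_trans]) simp
    also have "\<dots> < \<delta>" using \<phi>(3)[of e] \<psi>(3)[of e] by linarith
    finally have "dist (fm_val M e \<phi>, fm_val M e \<psi>) (P e, Q e) < \<delta>" .
    moreover have "(fm_val M e \<phi>, fm_val M e \<psi>) \<in> {0..1} \<times> {0..1}"
      using fm_val_in_unit[OF M] \<phi>(1) \<psi>(1) by blast
    moreover have "(P e, Q e) \<in> {0..1} \<times> {0..1}"
      using env_definable_in_unit[OF M] P Q by blast
    ultimately have "dist (u (fm_val M e \<phi>) (fm_val M e \<psi>)) (u (P e) (Q e)) < \<epsilon>"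
      using \<delta>(2)[of "(P e, Q e)" "(fm_val M e \<phi>, fm_val M e \<psi>)"] by simp
    then show ?thesis by (simp add: dist_real_def)
  qed
  ultimately show "\<exists>\<theta>. fm_over M A \<theta> \<and> free_vars \<theta> \<subseteq> V \<and>
      (\<forall>e. \<bar>fm_val M e \<theta> - u (P e) (Q e)\<bar> < \<epsilon>)"
    by blast
qed

lemma env_definable_max:
  fixes M :: "('m::complete_space, 'f, 'p) metric_structure"
  assumes "is_metric_structure M" "env_definable M A V P" "env_definable M A V Q"
  shows "env_definable M A V (\<lambda>e. max (P e) (Q e))"
proof (rule env_definable_conn2[OF assms])
  show "continuous_on ({0..1} \<times> {0..1}) (\<lambda>(s, t). max s (t::real))"
    unfolding case_prod_unfold by (intro continuous_intros)
qed auto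

lemma env_definable_conn1:
  fixes M :: "('m::complete_space, 'f, 'p) metric_structure"
  assumes "is_metric_structure M" "env_definable M A V P"
    and "continuous_on {0..1} u" "u ` {0..1} \<subseteq> {0..1}"
  shows "env_definable M A V (\<lambda>e. u (P e))"
proof (rule env_definable_conn2[OF assms(1,2,2), of "\<lambda>s t. u s"])
  show "continuous_on ({0..1} \<times> {0..1}) (\<lambda>(s, t::real). u s)"
    unfolding case_prod_unfold
    by (rule continuous_on_compose2[OF assms(3)]) (auto intro: continuous_on_fst continuous_on_id)
qed (use assms(4) in blast)

text \<open>Taking suprema is 1-Lipschitz for the uniform distance, so quantification preserves
  approximations.\<close>

lemma abs_cSUP_diff_le:
  fixes f g :: "'a \<Rightarrow> real"
  assumes "bdd_above (range f)" "bdd_above (range g)" "\<And>a. \<bar>f a - g a\<bar> \<le> \<epsilon>"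
  shows "\<bar>(SUP a. f a) - (SUP a. g a)\<bar> \<le> \<epsilon>"
proof -
  have "f a \<le> (SUP a. g a) + \<epsilon>" for a
    using cSUP_upper[OF UNIV_I assms(2), of a] assms(3)[of a] by linarith
  then have "(SUP a. f a) \<le> (SUP a. g a) + \<epsilon>"
    by (intro cSUP_least) auto
  moreover have "g a \<le> (SUP a. f a) + \<epsilon>" for a
    using cSUP_upper[OF UNIV_I assms(1), of a] assms(3)[of a] by linarith
  then have "(SUP a. g a) \<le> (SUP a. f a) + \<epsilon>"
    by (intro cSUP_least) auto
  ultimately show ?thesis by linarith
qed

lemma env_definable_SUP:
  fixes M :: "('m::complete_space, 'f, 'p) metric_structure"
  assumes M: "is_metric_structure M" and P: "env_definable M A V P"
  shows "env_definable M A (V - {i}) (\<lambda>e. SUP a. P (e(i := a)))"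
  unfolding env_definable_def
proof (intro allI impI)
  fix \<epsilon> :: real assume "\<epsilon> > 0"
  then obtain \<phi> where \<phi>: "fm_over M A \<phi>" "free_vars \<phi> \<subseteq> V"
    "\<And>e. \<bar>fm_val M e \<phi> - P e\<bar> < \<epsilon> / 2"
    using P unfolding env_definable_def by (metis half_gt_zero)
  \<comment> \<open>Strict bounds may become weak under a supremum; starting from
    \<open>\<epsilon> / 2\<close> leaves room to recover a strict one.\<close>
  have "\<bar>fm_val M e (QSup i \<phi>) - (SUP a. P (e(i := a)))\<bar> \<le> \<epsilon> / 2" for e
    unfolding fm_val.simps
  proof (rule abs_cSUP_diff_le)
    show "bdd_above (range (\<lambda>a. fm_val M (e(i := a)) \<phi>))"
      using fm_val_in_unit[OF M \<phi>(1)] by (intro bdd_aboveI[of _ 1]) auto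
    show "bdd_above (range (\<lambda>a. P (e(i := a))))"
      using env_definable_in_unit[OF M P] by (intro bdd_aboveI[of _ 1]) auto
  qed (use \<phi>(3) less_imp_le in blast)
  moreover have "\<epsilon> / 2 < \<epsilon>" using \<open>\<epsilon> > 0\<close> by simp
  ultimately have "\<bar>fm_val M e (QSup i \<phi>) - (SUP a. P (e(i := a)))\<bar> < \<epsilon>" for e
    by (rule le_less_trans)
  then show "\<exists>\<phi>. fm_over M A \<phi> \<and> free_vars \<phi> \<subseteq> V - {i} \<and>
      (\<forall>e. \<bar>fm_val M e \<phi> - (SUP a. P (e(i := a)))\<bar> < \<epsilon>)"
    using \<phi> by (intro exI[of _ "QSup i \<phi>"]) auto
qed

text \<open>Reduced to suprema through the connective \<open>1 - s\<close>, since an infimum of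
  \<open>P\<close> is one minus the supremum of \<open>1 - P\<close>.\<close>

lemma env_definable_INF:
  fixes M :: "('m::complete_space, 'f, 'p) metric_structure"
  assumes M: "is_metric_structure M" and P: "env_definable M A V P"
  shows "env_definable M A (V - {i}) (\<lambda>e. INF a. P (e(i := a)))"
proof -
  have bdd: "bdd_above (range (\<lambda>a. 1 - P (e(i := a))))" for e
    using env_definable_in_unit[OF M P] by (intro bdd_aboveI[of _ 1]) auto
  have "(INF a. P (e(i := a))) = 1 - (SUP a. 1 - P (e(i := a)))" for e
  proof (rule cInf_eq_non_empty)
    fix x assume "x \<in> range (\<lambda>a. P (e(i := a)))"
    then obtain a where "x = P (e(i := a))" by blast
    then show "1 - (SUP a. 1 - P (e(i := a))) \<le> x"
      using cSUP_upper[OF UNIV_I bdd, of e a] by simp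
  next
    fix y assume y: "\<And>x. x \<in> range (\<lambda>a. P (e(i := a))) \<Longrightarrow> y \<le> x"
    have "(SUP a. 1 - P (e(i := a))) \<le> 1 - y"
      by (rule cSUP_least) (use y in auto)
    then show "y \<le> 1 - (SUP a. 1 - P (e(i := a)))" by simp
  qed simp
  moreover have flip: "env_definable M A W (\<lambda>e. 1 - Q e)" if "env_definable M A W Q" for W Q
    by (rule env_definable_conn1[OF M that, of "\<lambda>s. 1 - s"]) (auto intro!: continuous_intros)
  have "env_definable M A (V - {i}) (\<lambda>e. 1 - (SUP a. 1 - P (e(i := a))))"
    by (intro flip env_definable_SUP[OF M] P)
  ultimately show ?thesis by simp
qed

section \<open>Metric linear orders\<close>

text \<open>A ball around one endpoint that contains the other contains everything between, by
  order-convexity. Taking as radius the distance to the middle point, which the open ball omits,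
  excludes the reverse inequality.\<close>

lemma
  fixes a b c :: "'m::metric_linear_order"
  assumes "a \<le> b" "b \<le> c"
  shows dist_mono_right: "dist a b \<le> dist a c"
    and dist_mono_left: "dist c b \<le> dist c a"
proof -
  have "b \<in> {x. dist a x < e}" if "c \<in> {x. dist a x < e}" for e
  proof -
    have "a \<in> {x. dist a x < e}"
      using that by (auto intro: le_less_trans[OF zero_le_dist])
    then show ?thesis
      using order_convex_ball[of a e] that assms unfolding order_convex_def by blast
  qed
  from this[of "dist a b"] have "\<not> dist a c < dist a b" by auto
  then show "dist a b \<le> dist a c" by simp
  have "b \<in> {x. dist c x < e}" if "a \<in> {x. dist c x < e}" for e
  proof -
    have "c \<in> {x. dist c x < e}"
      using that by (auto intro: le_less_trans[OF zero_le_dist])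
    then show ?thesis
      using order_convex_ball[of c e] that assms unfolding order_convex_def by blast
  qed
  from this[of "dist c b"] have "\<not> dist c a < dist c b" by auto
  then show "dist c b \<le> dist c a" by simp
qed

text \<open>The point of \<open>{..y}\<close> nearest to \<open>x\<close> is \<open>x\<close> itself
  if \<open>x \<le> y\<close>, and otherwise \<open>y\<close>, by monotonicity of the
  distance.\<close>

lemma ray_eq:
  fixes x y :: "'m::metric_linear_order"
  shows "ray x y = (if x \<le> y then 0 else dist x y)"
proof (cases "x \<le> y")
  case True
  have "(INF z\<in>{..y}. dist x z) = 0"
    by (rule cInf_eq_minimum) (use True in \<open>auto intro!: image_eqI[of _ _ x]\<close>)
  then show ?thesis using True by (simp add: ray_def)
next
  case False
  have "(INF z\<in>{..y}. dist x z) = dist x y"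
    by (rule cInf_eq_minimum) (use False in \<open>auto intro: dist_mono_left\<close>)
  then show ?thesis using False by (simp add: ray_def)
qed

text \<open>The ball around \<open>x < y\<close> of radius \<open>dist x y\<close> cannot reach
  \<open>y\<close> or anything above it.\<close>

lemma open_lessThan_metric_linear_order: "open {..<y::'m::metric_linear_order}"
  unfolding open_dist
proof
  fix x assume "x \<in> {..<y}"
  then have "x < y" by simp
  have "z < y" if "dist z x < dist x y" for z
    using that dist_mono_right[of x y z] \<open>x < y\<close> by (force simp: dist_commute)
  then show "\<exists>e>0. \<forall>z. dist z x < e \<longrightarrow> z \<in> {..<y}"
    using \<open>x < y\<close> by (intro exI[of _ "dist x y"]) auto
qed

text \<open>Without a greatest element, the open sets \<open>{..<y}\<close> with \<open>y\<close> in
  \<open>D\<close> would cover \<open>D\<close>, but the maximum of the indices of a finite subcover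
  is left out.\<close>

lemma compact_has_greatest:
  fixes D :: "'m::metric_linear_order set"
  assumes "compact D" "D \<noteq> {}"
  obtains b where "b \<in> D" "\<And>y. y \<in> D \<Longrightarrow> y \<le> b"
proof (rule ccontr)
  assume "\<not> thesis"
  then have "\<forall>b\<in>D. \<exists>y\<in>D. b < y" using that by (meson not_le)
  then have "D \<subseteq> (\<Union>y\<in>D. {..<y})" by auto
  then obtain F where F: "F \<subseteq> D" "finite F" "D \<subseteq> (\<Union>y\<in>F. {..<y})"
    by (rule compactE_image[OF assms(1) open_lessThan_metric_linear_order])
  then have "F \<noteq> {}" using assms(2) by auto
  then have "Max F \<in> D" using F Max_in by blast
  then obtain y where "y \<in> F" "Max F < y" using F(3) by auto
  then show False using Max_ge[OF F(2)] by (meson not_le)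
qed

section \<open>Definable subsets of a compact definable set\<close>

lemma compact_infdist_attained:
  fixes D :: "'m::metric_space set"
  assumes "compact D" "D \<noteq> {}"
  obtains z where "z \<in> D" "infdist x D = dist x z"
proof -
  obtain z where z: "z \<in> D" "\<And>y. y \<in> D \<Longrightarrow> dist x z \<le> dist x y"
    using continuous_attains_inf[OF assms continuous_on_dist[OF continuous_on_const continuous_on_id]]
    by blast
  have "infdist x D = dist x z"
    unfolding infdist_notempty[OF assms(2)] by (rule cInf_eq_minimum) (use z in auto)
  then show thesis using that z by blast
qed

lemma infdist_le_one: "infdist (x::'m::udlo) D \<le> 1"
proof (cases "D = {}")
  case False
  then obtain z where "z \<in> D" by blast
  then show ?thesis using infdist_le[of z D x] dist_le_one[of x z] by linarith
qed (simp add: infdist_def)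

lemma infdist_ultrametric:
  fixes D :: "'m::udlo set"
  assumes "compact D" "D \<noteq> {}"
  shows "infdist x D \<le> max (dist x y) (infdist y D)"
proof -
  obtain z where z: "z \<in> D" "infdist y D = dist y z"
    using compact_infdist_attained[OF assms] by blast
  have "infdist x D \<le> dist x z" using z(1) by (rule infdist_le)
  then show ?thesis using ultrametric[of x z y] z(2) by linarith
qed

text \<open>The ultrametric inequality lets the variable be changed by a quantifier instead of
  a renaming of the variables of the approximating formulas.\<close>

lemma env_definable_infdist_1:
  fixes M :: "('m::udlo, 'f, 'p) metric_structure"
  assumes M: "is_metric_structure M" and D: "compact D" "definable_set M A D"
  shows "env_definable M A {1} (\<lambda>e. infdist (e 1) D)"
proof -
  have ne: "D \<noteq> {}" and "env_definable M A {0} (\<lambda>e. infdist (e 0) D)"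
    using D(2) unfolding definable_set_def definable_pred_iff_env_definable by auto
  then have two: "env_definable M A {0, 1} (\<lambda>e. max (infdist (e 0) D) (dist (e 0) (e 1)))"
    by (intro env_definable_max[OF M] env_definable_dist) (erule env_definable_mono, simp)
  have "env_definable M A {1} (\<lambda>e. INF a. max (infdist a D) (dist a (e 1)))"
    using env_definable_INF[OF M two, of 0] by simp
  \<comment> \<open>The choice \<open>a = x\<close> attains the value, and no \<open>a\<close> does
    better by the ultrametric inequality.\<close>
  moreover have "(INF a. max (infdist a D) (dist a x)) = infdist x D" for x
  proof (rule cInf_eq_minimum)
    show "infdist x D \<in> range (\<lambda>a. max (infdist a D) (dist a x))"
      by (rule range_eqI[of _ _ x]) (simp add: infdist_nonneg)
    show "infdist x D \<le> y" if "y \<in> range (\<lambda>a. max (infdist a D) (dist a x))" for y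
      using that infdist_ultrametric[OF D(1) ne, of x] by (auto simp: dist_commute max.commute)
  qed
  ultimately show ?thesis by simp
qed

lemma definable_point_iff: "definable_point M A b \<longleftrightarrow> env_definable M A {0} (\<lambda>e. dist (e 0) b)"
  by (simp add: definable_point_def definable_set_def definable_pred_iff_env_definable)

text \<open>Above \<open>b\<close>, the distance to \<open>D\<close> is already the distance to
  \<open>b\<close>. Below \<open>b\<close>, the ray predicate recovers \<open>dist x b\<close> from
  the point \<open>b\<close> of \<open>D\<close>; subtracting \<open>infdist\<close> keeps points
  outside \<open>D\<close> from contributing too much.\<close>

lemma definable_point_greatest:
  fixes M :: "('m::udlo, 'f, 'p) metric_structure"
  assumes M: "is_metric_structure M" and ray: "has_ray_symbol M"
    and D: "compact D" "definable_set M A D"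
    and b: "b \<in> D" "\<And>y. y \<in> D \<Longrightarrow> y \<le> b"
  shows "definable_point M A b"
proof -
  have 0: "env_definable M A {0} (\<lambda>e. infdist (e 0) D)"
    using D(2) unfolding definable_set_def definable_pred_iff_env_definable by auto
  have two: "env_definable M A {0, 1} (\<lambda>e. max 0 (ray (e 1) (e 0) - infdist (e 1) D))"
  proof (rule env_definable_conn2[OF M, of A "{0, 1}" _ _ "\<lambda>s t. max 0 (s - t)"])
    show "env_definable M A {0, 1} (\<lambda>e. ray (e 1) (e 0))"
      using env_definable_ray[OF ray] by (rule env_definable_mono) auto
    show "env_definable M A {0, 1} (\<lambda>e. infdist (e 1) D)"
      using env_definable_infdist_1[OF M D] by (rule env_definable_mono) auto
  qed (auto simp: case_prod_unfold intro!: continuous_intros)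
  have "env_definable M A {0} (\<lambda>e. SUP a. max 0 (ray a (e 0) - infdist a D))"
    using env_definable_SUP[OF M two, of 1] by (simp add: insert_Diff_if)
  with 0 have "env_definable M A {0}
      (\<lambda>e. max (infdist (e 0) D) (SUP a. max 0 (ray a (e 0) - infdist a D)))"
    by (rule env_definable_max[OF M])
  moreover have "max (infdist x D) (SUP a. max 0 (ray a x - infdist a D)) = dist x b" for x
  proof -
    have above: "infdist y D = dist y b" if "b < y" for y
    proof -
      obtain z where "z \<in> D" "infdist y D = dist y z"
        using compact_infdist_attained[of D] D(1) b(1) by blast
      moreover from this have "dist y b \<le> dist y z"
        using b(2) that by (intro dist_mono_left) auto
      ultimately show ?thesis using infdist_le[OF b(1), of y] by simp
    qed
    \<comment> \<open>If \<open>a \<le> x\<close> the ray vanishes; if \<open>x < a \<le> b\<close>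
      monotonicity applies; if \<open>a\<close> exceeds both, \<open>infdist a D\<close> is
      \<open>dist a b\<close> and the triangle inequality suffices.\<close>
    have le: "max 0 (ray a x - infdist a D) \<le> dist x b" for a
    proof (cases "a \<le> x \<or> a \<le> b")
      case True
      then have "ray a x \<le> dist x b"
        using dist_mono_right[of x a b] by (auto simp: ray_eq dist_commute)
      then show ?thesis using infdist_nonneg[of a D] zero_le_dist[of x b] by linarith
    next
      case False
      then show ?thesis
        using above[of a] dist_triangle[of a x b] by (auto simp: ray_eq dist_commute)
    qed
    then have bdd: "bdd_above (range (\<lambda>a. max 0 (ray a x - infdist a D)))"
      by (intro bdd_aboveI[of _ "dist x b"]) auto
    have "(SUP a. max 0 (ray a x - infdist a D)) \<le> dist x b"
      by (rule cSUP_least) (use le in auto)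
    moreover have "infdist x D \<le> dist x b" using b(1) by (rule infdist_le)
    moreover have "dist x b \<le> infdist x D \<or> dist x b \<le> (SUP a. max 0 (ray a x - infdist a D))"
    proof (cases "b < x")
      case True
      then show ?thesis using above by simp
    next
      case False
      then have "dist x b \<le> max 0 (ray b x - infdist b D)"
        using b(1) by (auto simp: ray_eq dist_commute)
      then show ?thesis using cSUP_upper[OF UNIV_I bdd, of b] by linarith
    qed
    ultimately show ?thesis by linarith
  qed
  ultimately show ?thesis by (simp add: definable_point_iff)
qed

section \<open>Removing balls around definable points\<close>

text \<open>The distance to the remaining set is an infimum over \<open>a\<close> of
  \<open>dist x a\<close> combined with two penalties: \<open>v\<close> for being away from
  \<open>D\<close> and \<open>w\<close> for being near \<open>c\<close>. Both vanish on the
  remaining set.\<close>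

lemma definable_set_diff_ball:
  fixes M :: "('m::udlo, 'f, 'p) metric_structure"
  assumes M: "is_metric_structure M" and D: "compact D" "definable_set M A D"
    and c: "definable_point M A c" and \<epsilon>: "\<epsilon> > 0" and ne: "D - ball c \<epsilon> \<noteq> {}"
  shows "definable_set M A (D - ball c \<epsilon>)"
proof -
  let ?D' = "D - ball c \<epsilon>"
  have "D \<noteq> {}" using ne by blast
  have cpt: "compact ?D'" using D(1) by (rule compact_diff) simp
  \<comment> \<open>In an ultrametric a ball of the same radius around a point outside
    \<open>ball c \<epsilon>\<close> is disjoint from it, so the ball is also closed.\<close>
  have "- ball c \<epsilon> = (\<Union>y\<in>- ball c \<epsilon>. ball y \<epsilon>)"
  proof (rule set_eqI)
    fix z
    have "z \<notin> ball c \<epsilon>" if "y \<notin> ball c \<epsilon>" "z \<in> ball y \<epsilon>" for y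
      using that ultrametric[of c y z] by (auto simp: dist_commute)
    moreover have "z \<in> ball z \<epsilon>" using \<epsilon> by simp
    ultimately show "z \<in> - ball c \<epsilon> \<longleftrightarrow> z \<in> (\<Union>y\<in>- ball c \<epsilon>. ball y \<epsilon>)"
      by blast
  qed
  then have "closed (ball c \<epsilon>)" unfolding closed_def by (metis open_UN open_ball)
  then have cpt': "compact (D \<inter> ball c \<epsilon>)" using D(1) by (simp add: compact_Int_closed)
  \<comment> \<open>No point of \<open>D\<close> has distance from \<open>c\<close> strictly between
    \<open>\<eta>\<close> and \<open>\<epsilon>\<close>, since the distance attains its maximum on
    the compact part inside the ball. The value \<open>\<epsilon> / 2\<close> only secures
    positivity.\<close>
  obtain \<eta> where \<eta>: "0 < \<eta>" "\<eta> < \<epsilon>" "\<And>y. y \<in> D \<Longrightarrow> dist y c < \<epsilon> \<Longrightarrow> dist y c \<le> \<eta>"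
  proof (cases "D \<inter> ball c \<epsilon> = {}")
    case True
    then show thesis using \<epsilon> by (intro that[of "\<epsilon> / 2"]) (auto simp: dist_commute)
  next
    case False
    obtain y where "y \<in> D \<inter> ball c \<epsilon>" "\<And>z. z \<in> D \<inter> ball c \<epsilon> \<Longrightarrow> dist c z \<le> dist c y"
      using continuous_attains_sup[OF cpt' False
          continuous_on_dist[OF continuous_on_const continuous_on_id]]
      by blast
    then show thesis using \<epsilon>
      by (intro that[of "max (\<epsilon> / 2) (dist c y)"]) (auto simp: dist_commute le_max_iff_disj)
  qed
  \<comment> \<open>The bound by 1 gives \<open>v t \<ge> t\<close> on \<open>[0,1]\<close>; the
    bound by \<open>\<eta>\<close> lets moves shorter than \<open>\<delta>\<close> preserve being
    farther than \<open>\<eta>\<close> from \<open>c\<close>.\<close>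
  define \<delta> where "\<delta> = min 1 \<eta>"
  have \<delta>: "0 < \<delta>" "\<delta> \<le> 1" "\<delta> \<le> \<eta>" using \<eta> by (auto simp: \<delta>_def)
  define v where "v t = min 1 (t / \<delta>)" for t :: real
  \<comment> \<open>A ramp falling from 1 at \<open>\<eta>\<close> to 0 at
    \<open>\<epsilon>\<close>: it is continuous, yet separates the two parts of \<open>D\<close>
    exactly because of the gap.\<close>
  define w where "w t = min 1 (max 0 ((\<epsilon> - t) / (\<epsilon> - \<eta>)))" for t :: real
  have v: "continuous_on {0..1} v" "v ` {0..1} \<subseteq> {0..1}"
    using \<delta>(1) by (auto simp: v_def intro!: continuous_intros)
  have w: "continuous_on {0..1} w" "w ` {0..1} \<subseteq> {0..1}"
    using \<eta>(2) by (auto simp: w_def intro!: continuous_intros)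
  have w_far: "w t = 0" if "t \<ge> \<epsilon>" for t
    using that \<eta>(2) divide_nonpos_pos[of "\<epsilon> - t" "\<epsilon> - \<eta>"] by (simp add: w_def)
  have w_near: "w t = 1" if "t \<le> \<eta>" for t
    using that \<eta>(2) by (simp add: w_def le_max_iff_disj)
  have "definable_set M A {c}" using c by (simp add: definable_point_def)
  from env_definable_infdist_1[OF M _ this]
  have "env_definable M A {1} (\<lambda>e. dist (e 1) c)" by simp
  from env_definable_conn1[OF M this w]
  have "env_definable M A {0, 1} (\<lambda>e. w (dist (e 1) c))" by (rule env_definable_mono) auto
  moreover from env_definable_conn1[OF M env_definable_infdist_1[OF M D] v]
  have "env_definable M A {0, 1} (\<lambda>e. v (infdist (e 1) D))" by (rule env_definable_mono) auto
  ultimately have two: "env_definable M A {0, 1}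
      (\<lambda>e. max (dist (e 0) (e 1)) (max (v (infdist (e 1) D)) (w (dist (e 1) c))))"
    by (intro env_definable_max[OF M] env_definable_dist)
  have "env_definable M A {0}
      (\<lambda>e. INF a. max (dist (e 0) a) (max (v (infdist a D)) (w (dist a c))))"
    using env_definable_INF[OF M two, of 1] by (simp add: insert_Diff_if)
  moreover have "(INF a. max (dist x a) (max (v (infdist a D)) (w (dist a c)))) = infdist x ?D'" for x
  proof (rule cInf_eq_minimum)
    obtain z where z: "z \<in> ?D'" "infdist x ?D' = dist x z"
      using compact_infdist_attained[OF cpt ne] by blast
    then have "w (dist z c) = 0" by (intro w_far) (auto simp: dist_commute)
    moreover have "v (infdist z D) = 0" using z by (simp add: v_def)
    ultimately show "infdist x ?D' \<in> range (\<lambda>a. max (dist x a) (max (v (infdist a D)) (w (dist a c))))"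
      using z(2) by (intro range_eqI[of _ _ z]) simp
  next
    fix y assume "y \<in> range (\<lambda>a. max (dist x a) (max (v (infdist a D)) (w (dist a c))))"
    then obtain a where y: "y = max (dist x a) (max (v (infdist a D)) (w (dist a c)))" by blast
    obtain z where z: "z \<in> D" "infdist a D = dist a z"
      using compact_infdist_attained[OF D(1) \<open>D \<noteq> {}\<close>] by blast
    \<comment> \<open>In the first two cases a penalty equals 1, which bounds every distance. In the
      third, the nearest point \<open>z\<close> of \<open>D\<close> is still farther than
      \<open>\<eta>\<close> from \<open>c\<close>, hence outside the ball by the gap.\<close>
    consider "dist a z \<ge> \<delta>" | "dist a c \<le> \<eta>" | "dist a z < \<delta>" "dist a c > \<eta>" by linarith
    then show "infdist x ?D' \<le> y"
    proof cases
      case 1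
      then have "v (infdist a D) = 1" using \<delta>(1) z(2) by (simp add: v_def)
      then show ?thesis using y infdist_le_one[of x ?D'] by simp
    next
      case 2
      then show ?thesis using y infdist_le_one[of x ?D'] w_near by simp
    next
      case 3
      have "dist z c > \<eta>" using 3 \<delta>(3) ultrametric[of a c z] by auto
      then have "z \<in> ?D'" using \<eta>(3)[OF z(1)] z(1) by (force simp: dist_commute)
      then have "infdist x ?D' \<le> dist x z" by (rule infdist_le)
      moreover have "dist x z \<le> max (dist x a) (dist a z)" by (rule ultrametric)
      moreover have "dist a z \<le> v (infdist a D)"
        using \<delta> z(2) dist_le_one[of a z] by (simp add: v_def pos_le_divide_eq mult_left_le)
      ultimately show ?thesis using y by linarith
    qed
  qed
  ultimately have "env_definable M A {0} (\<lambda>e. infdist (e 0) ?D')" by simp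
  then show ?thesis
    using cpt ne unfolding definable_set_def definable_pred_iff_env_definable
    by (simp add: compact_imp_closed)
qed

text \<open>The balls are removed one at a time; each intermediate set is nonempty because it
  contains the final one.\<close>

lemma definable_set_diff_balls:
  fixes M :: "('m::udlo, 'f, 'p) metric_structure"
  assumes M: "is_metric_structure M" and D: "compact D" "definable_set M A D"
    and F: "finite F" "\<And>c. c \<in> F \<Longrightarrow> definable_point M A c"
    and \<epsilon>: "\<epsilon> > 0" and ne: "D - (\<Union>c\<in>F. ball c \<epsilon>) \<noteq> {}"
  shows "definable_set M A (D - (\<Union>c\<in>F. ball c \<epsilon>))"
  using F ne
proof (induction F rule: finite_induct)
  case empty
  then show ?case using D by simp
next
  case (insert c F)
  have eq: "D - (\<Union>c\<in>insert c F. ball c \<epsilon>) = (D - (\<Union>c\<in>F. ball c \<epsilon>)) - ball c \<epsilon>" by blast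
  have "compact (D - (\<Union>c\<in>F. ball c \<epsilon>))" using D(1) by (rule compact_diff) auto
  moreover have "definable_set M A (D - (\<Union>c\<in>F. ball c \<epsilon>))"
    using insert.prems by (intro insert.IH) auto
  ultimately show ?case
    unfolding eq using insert.prems by (intro definable_set_diff_ball[OF M _ _ _ \<epsilon>]) auto
qed

section \<open>Density and limits of definable points\<close>

lemma definable_points_dense:
  fixes M :: "('m::udlo, 'f, 'p) metric_structure"
  assumes M: "is_metric_structure M" and ray: "has_ray_symbol M"
    and D: "compact D" "definable_set M A D" and b: "b \<in> D" and \<epsilon>: "\<epsilon> > 0"
  shows "\<exists>c. definable_point M A c \<and> dist b c < \<epsilon>"
proof (rule ccontr)
  assume far: "\<nexists>c. definable_point M A c \<and> dist b c < \<epsilon>"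
  let ?E = "{c \<in> D. definable_point M A c}"
  \<comment> \<open>Compactness of \<open>?E\<close> itself is not known, but its closure in
    \<open>D\<close> is compact and still covered by the \<open>\<epsilon>\<close>-balls around
    points of \<open>?E\<close>, so finitely many of them suffice.\<close>
  have "compact (D \<inter> closure ?E)" using D(1) by (simp add: compact_Int_closed)
  moreover have "D \<inter> closure ?E \<subseteq> (\<Union>c\<in>?E. ball c \<epsilon>)"
  proof
    fix x assume "x \<in> D \<inter> closure ?E"
    then show "x \<in> (\<Union>c\<in>?E. ball c \<epsilon>)"
      using \<epsilon> closure_approachable[of x ?E] by auto
  qed
  ultimately obtain F where F: "F \<subseteq> ?E" "finite F" "D \<inter> closure ?E \<subseteq> (\<Union>c\<in>F. ball c \<epsilon>)"
    by (rule compactE_image[OF _ open_ball])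
  let ?D' = "D - (\<Union>c\<in>F. ball c \<epsilon>)"
  \<comment> \<open>The point \<open>b\<close> survives, as no definable point is within
    \<open>\<epsilon>\<close> of it.\<close>
  have ne: "?D' \<noteq> {}" using b far F(1) by (force simp: dist_commute)
  have cpt: "compact ?D'" using D(1) by (rule compact_diff) auto
  have "definable_set M A ?D'"
    using F by (intro definable_set_diff_balls[OF M D _ _ \<epsilon> ne]) auto
  moreover obtain m where "m \<in> ?D'" "\<And>y. y \<in> ?D' \<Longrightarrow> y \<le> m"
    using compact_has_greatest[OF cpt ne] by blast
  ultimately have "definable_point M A m"
    using definable_point_greatest[OF M ray cpt] by blast
  \<comment> \<open>As a definable point of \<open>D\<close>, the maximum \<open>m\<close> lies in
    \<open>?E\<close> and hence in one of the removed balls.\<close>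
  then have "m \<in> D \<inter> closure ?E" using \<open>m \<in> ?D'\<close> closure_subset[of ?E] by blast
  then show False using \<open>m \<in> ?D'\<close> F(3) by blast
qed

text \<open>The distance functions to \<open>c\<close> and to \<open>b\<close> differ everywhere by
  at most \<open>dist b c\<close>, so the latter is a uniform limit of definable predicates.\<close>

lemma definable_point_limit:
  assumes "\<And>\<epsilon>. \<epsilon> > 0 \<Longrightarrow> \<exists>c. definable_point M A c \<and> dist b c < \<epsilon>"
  shows "definable_point M A b"
  unfolding definable_point_iff
proof (rule env_definable_limit)
  fix \<epsilon> :: real assume "\<epsilon> > 0"
  then obtain c where c: "definable_point M A c" "dist b c < \<epsilon>" using assms by blast
  have "\<bar>dist x c - dist x b\<bar> < \<epsilon>" for x
    using c(2) dist_triangle[of x b c] dist_triangle[of x c b] by (simp add: dist_commute)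
  then show "\<exists>Q. env_definable M A {0} Q \<and> (\<forall>e. \<bar>Q e - dist (e 0) b\<bar> < \<epsilon>)"
    using c(1) unfolding definable_point_iff by (intro exI[of _ "\<lambda>e. dist (e 0) c"]) simp
qed

theorem theorem7p9:
  fixes M :: "('m::udlo, 'f, 'p) metric_structure" and A :: "'m set"
  assumes "weakly_o_minimal M"
  shows "(\<forall>D. compact D \<and> definable_set M A D \<longrightarrow> (\<forall>b\<in>D. definable_point M A b)) \<and>
         acl M A = dcl M A"
proof -
  have "definable_point M A b" if "compact D" "definable_set M A D" "b \<in> D" for D b
    using assms that unfolding weakly_o_minimal_def
    by (intro definable_point_limit definable_points_dense[of M D]) auto
  moreover from this have "acl M A \<subseteq> dcl M A" unfolding acl_def dcl_def by blast
  moreover have "dcl M A \<subseteq> acl M A"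
    unfolding acl_def dcl_def definable_point_def using compact_sing by blast
  ultimately show ?thesis by blast
qed

end
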